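(* Let $L$ be a first-order language with equality and let $T$ be a theory axiomatized by $L$-sentences of the form $\forall\vec{x}\,(\psi_0(\vec{x})\to\psi_1(\vec{x}))$, where $\psi_0(\vec{x}),\psi_1(\vec{x})$ are formulas in $\exists^{+}(L)$. Let $\mathcal A=\mathrm{Mod}(T)$ be the full subcategory of $\mathbf{L\text{-}mod}$ whose objects are the models of $T$. Then $\mathcal A$ has profinite objects, that is, $\mathcal A$ is closed in $\mathbf{L\text{-}mod}$ under the formation of such limits: for every diagram of finite $L$-structures and $L$-homomorphisms over a downward directed poset, all of whose structures belong to $\mathcal A$, the limit of the diagram in $\mathbf{L\text{-}mod}$ belongs to $\mathcal A$.
   Context: $L$ is an arbitrary first-order language with equality. $\mathbf{L\text{-}mod}$ is the category of all $L$-structures (the empty structure is allowed) and $L$-homomorphisms (maps preserving constants and operations, and preserving, not necessarily reflecting, relations). An $L$-formula is existential positive if it is obtained from atomic formulas (including equalities of terms) using the connectives $\wedge,\vee$ and the existential quantifier $\exists$; $\exists^{+}(L)$ denotes the set of all $L$-formulas logically equivalent, in the classical predicate calculus, to an existential positive formula. A poset $\langle I,\le\rangle$ is downward directed if $I\neq\emptyset$ and any two elements have a common lower bound. An $L$-structure is profinite if it is $L$-isomorphic to the limit in $\mathbf{L\text{-}mod}$ of a diagram of finite $L$-structures over a downward directed poset. *)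

theory Defs
  imports Main "HOL-Library.FuncSet" "HOL-Library.Countable_Set"
begin

section \<open>Languages, structures and homomorphisms\<close>

text \<open>Constants are function symbols of arity 0. The symbols form subsets of the types
  \<^typ>\<open>'f\<close> and \<^typ>\<open>'r\<close>, so that a language may lack symbols of either kind.\<close>

record ('f, 'r) language =
  fsyms :: "'f set"
  farity :: "'f \<Rightarrow> nat"
  rsyms :: "'r set"
  rarity :: "'r \<Rightarrow> nat"

record ('f, 'r, 'a) lstruct =
  univ :: "'a set"
  fint :: "'f \<Rightarrow> 'a list \<Rightarrow> 'a"
  rint :: "'r \<Rightarrow> 'a list \<Rightarrow> bool"

text \<open>The universe may be empty (which the closure condition permits only in the absence of
  constants). Values of the interpretations outside the universe, at wrong arities or at
  non-symbols are irrelevant.\<close>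

definition lstructure :: "('f, 'r) language \<Rightarrow> ('f, 'r, 'a) lstruct \<Rightarrow> bool" where
  "lstructure L M \<longleftrightarrow>
    (\<forall>f\<in>fsyms L. \<forall>xs. length xs = farity L f \<and> set xs \<subseteq> univ M \<longrightarrow> fint M f xs \<in> univ M)"

definition lhom :: "('f, 'r) language \<Rightarrow> ('f, 'r, 'a) lstruct \<Rightarrow> ('f, 'r, 'b) lstruct \<Rightarrow> ('a \<Rightarrow> 'b) \<Rightarrow> bool" where
  "lhom L M N h \<longleftrightarrow>
    (\<forall>x\<in>univ M. h x \<in> univ N) \<and>
    (\<forall>f\<in>fsyms L. \<forall>xs. length xs = farity L f \<and> set xs \<subseteq> univ M \<longrightarrow>
      h (fint M f xs) = fint N f (map h xs)) \<and>
    (\<forall>R\<in>rsyms L. \<forall>xs. length xs = rarity L R \<and> set xs \<subseteq> univ M \<longrightarrow>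
      rint M R xs \<longrightarrow> rint N R (map h xs))"


section \<open>Formulas and satisfaction\<close>

datatype 'f tm = Var nat | Fun 'f "'f tm list"

datatype ('f, 'r) fm =
    Falsum
  | Eq "'f tm" "'f tm"
  | Rel 'r "'f tm list"
  | Neg "('f, 'r) fm"
  | And "('f, 'r) fm" "('f, 'r) fm"
  | Or "('f, 'r) fm" "('f, 'r) fm"
  | Imp "('f, 'r) fm" "('f, 'r) fm"
  | Ex nat "('f, 'r) fm"
  | All nat "('f, 'r) fm"

fun lterm :: "('f, 'r) language \<Rightarrow> 'f tm \<Rightarrow> bool" where
  "lterm L (Var n) \<longleftrightarrow> True"
| "lterm L (Fun f ts) \<longleftrightarrow> f \<in> fsyms L \<and> length ts = farity L f \<and> (\<forall>t\<in>set ts. lterm L t)"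

fun lformula :: "('f, 'r) language \<Rightarrow> ('f, 'r) fm \<Rightarrow> bool" where
  "lformula L Falsum \<longleftrightarrow> True"
| "lformula L (Eq s t) \<longleftrightarrow> lterm L s \<and> lterm L t"
| "lformula L (Rel R ts) \<longleftrightarrow> R \<in> rsyms L \<and> length ts = rarity L R \<and> (\<forall>t\<in>set ts. lterm L t)"
| "lformula L (Neg \<phi>) \<longleftrightarrow> lformula L \<phi>"
| "lformula L (And \<phi> \<psi>) \<longleftrightarrow> lformula L \<phi> \<and> lformula L \<psi>"
| "lformula L (Or \<phi> \<psi>) \<longleftrightarrow> lformula L \<phi> \<and> lformula L \<psi>"
| "lformula L (Imp \<phi> \<psi>) \<longleftrightarrow> lformula L \<phi> \<and> lformula L \<psi>"
| "lformula L (Ex n \<phi>) \<longleftrightarrow> lformula L \<phi>"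
| "lformula L (All n \<phi>) \<longleftrightarrow> lformula L \<phi>"

fun tm_fv :: "'f tm \<Rightarrow> nat set" where
  "tm_fv (Var n) = {n}"
| "tm_fv (Fun f ts) = (\<Union>t\<in>set ts. tm_fv t)"

fun fv :: "('f, 'r) fm \<Rightarrow> nat set" where
  "fv Falsum = {}"
| "fv (Eq s t) = tm_fv s \<union> tm_fv t"
| "fv (Rel R ts) = (\<Union>t\<in>set ts. tm_fv t)"
| "fv (Neg \<phi>) = fv \<phi>"
| "fv (And \<phi> \<psi>) = fv \<phi> \<union> fv \<psi>"
| "fv (Or \<phi> \<psi>) = fv \<phi> \<union> fv \<psi>"
| "fv (Imp \<phi> \<psi>) = fv \<phi> \<union> fv \<psi>"
| "fv (Ex n \<phi>) = fv \<phi> - {n}"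
| "fv (All n \<phi>) = fv \<phi> - {n}"

definition lsentence :: "('f, 'r) language \<Rightarrow> ('f, 'r) fm \<Rightarrow> bool" where
  "lsentence L \<phi> \<longleftrightarrow> lformula L \<phi> \<and> fv \<phi> = {}"

fun tm_val :: "('f, 'r, 'a) lstruct \<Rightarrow> (nat \<Rightarrow> 'a) \<Rightarrow> 'f tm \<Rightarrow> 'a" where
  "tm_val M e (Var n) = e n"
| "tm_val M e (Fun f ts) = fint M f (map (tm_val M e) ts)"

fun sat :: "('f, 'r, 'a) lstruct \<Rightarrow> (nat \<Rightarrow> 'a) \<Rightarrow> ('f, 'r) fm \<Rightarrow> bool" where
  "sat M e Falsum \<longleftrightarrow> False"
| "sat M e (Eq s t) \<longleftrightarrow> tm_val M e s = tm_val M e t"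
| "sat M e (Rel R ts) \<longleftrightarrow> rint M R (map (tm_val M e) ts)"
| "sat M e (Neg \<phi>) \<longleftrightarrow> \<not> sat M e \<phi>"
| "sat M e (And \<phi> \<psi>) \<longleftrightarrow> sat M e \<phi> \<and> sat M e \<psi>"
| "sat M e (Or \<phi> \<psi>) \<longleftrightarrow> sat M e \<phi> \<or> sat M e \<psi>"
| "sat M e (Imp \<phi> \<psi>) \<longleftrightarrow> (sat M e \<phi> \<longrightarrow> sat M e \<psi>)"
| "sat M e (Ex n \<phi>) \<longleftrightarrow> (\<exists>a\<in>univ M. sat M (e(n := a)) \<phi>)"
| "sat M e (All n \<phi>) \<longleftrightarrow> (\<forall>a\<in>univ M. sat M (e(n := a)) \<phi>)"

text \<open>Assignments range over the whole type \<^typ>\<open>'a\<close>, not over the universe: the empty structure has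
  no assignment into its universe, yet must satisfy some sentences and refute others. The truth
  value of a sentence does not depend on the assignment (\<open>sat_cong\<close> below).\<close>

definition is_model :: "('f, 'r) language \<Rightarrow> ('f, 'r) fm set \<Rightarrow> ('f, 'r, 'a) lstruct \<Rightarrow> bool" where
  "is_model L T M \<longleftrightarrow> lstructure L M \<and> (\<forall>\<sigma>\<in>T. \<forall>e. sat M e \<sigma>)"

lemma tm_val_cong: "(\<And>n. n \<in> tm_fv t \<Longrightarrow> e n = e' n) \<Longrightarrow> tm_val M e t = tm_val M e' t"
proof (induction t)
  case (Fun f ts)
  have "map (tm_val M e) ts = map (tm_val M e') ts"
    using Fun by (intro map_cong) auto
  then show ?case by (simp cong: map_cong)
qed simp

lemma sat_cong: "(\<And>n. n \<in> fv \<phi> \<Longrightarrow> e n = e' n) \<Longrightarrow> sat M e \<phi> = sat M e' \<phi>"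
proof (induction \<phi> arbitrary: e e')
  case (Eq s t)
  then show ?case using tm_val_cong[of s e e' M] tm_val_cong[of t e e' M] by simp
next
  case (Rel R ts)
  then have "map (tm_val M e) ts = map (tm_val M e') ts"
    by (intro map_cong) (auto intro!: tm_val_cong)
  then show ?case by (simp cong: map_cong)
next
  case (Neg \<phi>)
  show ?case using Neg.IH[of e e'] Neg.prems by simp
next
  case (And \<phi> \<psi>)
  show ?case using And.IH(1)[of e e'] And.IH(2)[of e e'] And.prems by simp
next
  case (Or \<phi> \<psi>)
  show ?case using Or.IH(1)[of e e'] Or.IH(2)[of e e'] Or.prems by simp
next
  case (Imp \<phi> \<psi>)
  show ?case using Imp.IH(1)[of e e'] Imp.IH(2)[of e e'] Imp.prems by simp
next
  case (Ex n \<phi>)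
  have "sat M (e(n := a)) \<phi> = sat M (e'(n := a)) \<phi>" for a
    using Ex.prems by (intro Ex.IH) auto
  then show ?case by simp
next
  case (All n \<phi>)
  have "sat M (e(n := a)) \<phi> = sat M (e'(n := a)) \<phi>" for a
    using All.prems by (intro All.IH) auto
  then show ?case by simp
qed simp


section \<open>Existential positive formulas\<close>

text \<open>\<^term>\<open>Falsum\<close> counts as an atomic formula, which admits axioms such as
  \<open>\<forall>x. \<psi>(x) \<longrightarrow> \<bottom>\<close>.\<close>

fun ex_pos :: "('f, 'r) fm \<Rightarrow> bool" where
  "ex_pos Falsum \<longleftrightarrow> True"
| "ex_pos (Eq s t) \<longleftrightarrow> True"
| "ex_pos (Rel R ts) \<longleftrightarrow> True"
| "ex_pos (And \<phi> \<psi>) \<longleftrightarrow> ex_pos \<phi> \<and> ex_pos \<psi>"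
| "ex_pos (Or \<phi> \<psi>) \<longleftrightarrow> ex_pos \<phi> \<and> ex_pos \<psi>"
| "ex_pos (Ex n \<phi>) \<longleftrightarrow> ex_pos \<phi>"
| "ex_pos (Neg \<phi>) \<longleftrightarrow> False"
| "ex_pos (Imp \<phi> \<psi>) \<longleftrightarrow> False"
| "ex_pos (All n \<phi>) \<longleftrightarrow> False"

text \<open>Logical equivalence in the classical predicate calculus means agreement in all nonempty
  structures. A definition cannot quantify over all types of elements; since a formula contains
  only finitely many symbols, structures with universe in \<^typ>\<open>nat\<close> suffice, by the downward
  Loewenheim-Skolem theorem (proved below as \<open>logically_equivalentD\<close>).\<close>

definition logically_equivalent :: "('f, 'r) language \<Rightarrow> ('f, 'r) fm \<Rightarrow> ('f, 'r) fm \<Rightarrow> bool" where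
  "logically_equivalent L \<phi> \<psi> \<longleftrightarrow>
    (\<forall>M :: ('f, 'r, nat) lstruct. lstructure L M \<and> univ M \<noteq> {} \<longrightarrow>
      (\<forall>e. range e \<subseteq> univ M \<longrightarrow> sat M e \<phi> = sat M e \<psi>))"

definition ex_pos_class :: "('f, 'r) language \<Rightarrow> ('f, 'r) fm set" where
  "ex_pos_class L =
    {\<phi>. lformula L \<phi> \<and> (\<exists>\<psi>. lformula L \<psi> \<and> ex_pos \<psi> \<and> logically_equivalent L \<phi> \<psi>)}"


subsection \<open>Logical equivalence over arbitrary universes\<close>

fun tm_funs :: "'f tm \<Rightarrow> 'f set" where
  "tm_funs (Var n) = {}"
| "tm_funs (Fun f ts) = insert f (\<Union>t\<in>set ts. tm_funs t)"

fun fm_funs :: "('f, 'r) fm \<Rightarrow> 'f set" where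
  "fm_funs Falsum = {}"
| "fm_funs (Eq s t) = tm_funs s \<union> tm_funs t"
| "fm_funs (Rel R ts) = (\<Union>t\<in>set ts. tm_funs t)"
| "fm_funs (Neg \<phi>) = fm_funs \<phi>"
| "fm_funs (And \<phi> \<psi>) = fm_funs \<phi> \<union> fm_funs \<psi>"
| "fm_funs (Or \<phi> \<psi>) = fm_funs \<phi> \<union> fm_funs \<psi>"
| "fm_funs (Imp \<phi> \<psi>) = fm_funs \<phi> \<union> fm_funs \<psi>"
| "fm_funs (Ex n \<phi>) = fm_funs \<phi>"
| "fm_funs (All n \<phi>) = fm_funs \<phi>"

fun subfms :: "('f, 'r) fm \<Rightarrow> ('f, 'r) fm set" where
  "subfms Falsum = {Falsum}"
| "subfms (Eq s t) = {Eq s t}"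
| "subfms (Rel R ts) = {Rel R ts}"
| "subfms (Neg \<phi>) = insert (Neg \<phi>) (subfms \<phi>)"
| "subfms (And \<phi> \<psi>) = insert (And \<phi> \<psi>) (subfms \<phi> \<union> subfms \<psi>)"
| "subfms (Or \<phi> \<psi>) = insert (Or \<phi> \<psi>) (subfms \<phi> \<union> subfms \<psi>)"
| "subfms (Imp \<phi> \<psi>) = insert (Imp \<phi> \<psi>) (subfms \<phi> \<union> subfms \<psi>)"
| "subfms (Ex n \<phi>) = insert (Ex n \<phi>) (subfms \<phi>)"
| "subfms (All n \<phi>) = insert (All n \<phi>) (subfms \<phi>)"

lemma finite_tm_funs: "finite (tm_funs t)"
  by (induction t) auto

lemma finite_fm_funs: "finite (fm_funs \<phi>)"
  by (induction \<phi>) (auto simp: finite_tm_funs)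

lemma finite_tm_fv: "finite (tm_fv t)"
  by (induction t) auto

lemma finite_fv: "finite (fv \<phi>)"
  by (induction \<phi>) (auto simp: finite_tm_fv)

lemma finite_subfms: "finite (subfms \<phi>)"
  by (induction \<phi>) auto

lemma self_in_subfms: "\<phi> \<in> subfms \<phi>"
  by (cases \<phi>) auto

lemma countable_closure:
  fixes G :: "('a list \<Rightarrow> 'a) set"
  assumes G: "countable G" and G_closed: "\<And>g xs. g \<in> G \<Longrightarrow> set xs \<subseteq> U \<Longrightarrow> g xs \<in> U"
    and C0: "countable C0" "C0 \<subseteq> U"
  obtains C where "countable C" "C0 \<subseteq> C" "C \<subseteq> U" "\<And>g xs. g \<in> G \<Longrightarrow> set xs \<subseteq> C \<Longrightarrow> g xs \<in> C"
proof -
  define step where "step X = X \<union> (\<Union>g\<in>G. g ` lists X)" for X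
  define C where "C k = (step ^^ k) C0" for k
  have C_Suc: "C (Suc k) = step (C k)" for k by (simp add: C_def)
  have cnt: "countable (C k)" for k
    by (induction k) (use G C0 in \<open>auto simp: C_Suc step_def C_def[of 0]\<close>)
  have sub: "C k \<subseteq> U" for k
  proof (induction k)
    case 0
    then show ?case using C0 by (simp add: C_def)
  next
    case (Suc k)
    then show ?case using G_closed by (auto simp: C_Suc step_def lists_eq_set)
  qed
  have mono: "C k \<subseteq> C l" if "k \<le> l" for k l
    using that by (rule lift_Suc_mono_le[rotated]) (auto simp: C_Suc step_def)
  have fin: "\<exists>k. set xs \<subseteq> C k" if "set xs \<subseteq> (\<Union>k. C k)" for xs
    using that
  proof (induction xs)
    case (Cons x xs)
    then obtain k l where "set xs \<subseteq> C k" "x \<in> C l" by auto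
    then have "set (x # xs) \<subseteq> C (max k l)"
      using mono[of k "max k l"] mono[of l "max k l"] by auto
    then show ?case ..
  qed auto
  have closed: "g xs \<in> (\<Union>k. C k)" if g: "g \<in> G" and xs: "set xs \<subseteq> (\<Union>k. C k)" for g xs
  proof -
    obtain k where "set xs \<subseteq> C k" using fin[OF xs] ..
    then have "g xs \<in> C (Suc k)" using g by (auto simp: C_Suc step_def lists_eq_set)
    then show ?thesis by blast
  qed
  show thesis
  proof (rule that[of "\<Union>k. C k"])
    have "C0 = C 0" by (simp add: C_def)
    then show "C0 \<subseteq> (\<Union>k. C k)" by blast
  qed (use cnt sub closed in auto)
qed

lemma tm_val_closed:
  assumes "lstructure L M" "range e \<subseteq> univ M" "lterm L t"
  shows "tm_val M e t \<in> univ M"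
  using assms(3)
proof (induction t)
  case (Fun f ts)
  then have "set (map (tm_val M e) ts) \<subseteq> univ M" by auto
  then show ?case using Fun.prems assms(1) by (simp add: lstructure_def)
qed (use assms in auto)

lemma tm_val_transfer:
  assumes ops: "\<And>f xs. f \<in> S \<Longrightarrow> length xs = farity L f \<Longrightarrow> set xs \<subseteq> C \<Longrightarrow>
      fint M f xs \<in> C \<and> fint N f (map g xs) = g (fint M f xs)"
    and "lterm L t" "tm_funs t \<subseteq> S" "range e \<subseteq> C"
  shows "tm_val M e t \<in> C \<and> tm_val N (g \<circ> e) t = g (tm_val M e t)"
  using assms(2,3)
proof (induction t)
  case (Var n)
  then show ?case using assms(4) by auto
next
  case (Fun f ts)
  then have IH: "tm_val M e t \<in> C \<and> tm_val N (g \<circ> e) t = g (tm_val M e t)" if "t \<in> set ts" for t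
    using that Fun.IH[OF that] Fun.prems by fastforce
  then have "map (tm_val N (g \<circ> e)) ts = map g (map (tm_val M e) ts)" by auto
  then show ?case using ops[of f "map (tm_val M e) ts"] Fun.prems IH
    by (simp add: image_subset_iff comp_def cong: map_cong)
qed

lemma countable_model:
  fixes M :: "('f, 'r, 'a) lstruct"
  assumes M: "lstructure L M" and e: "range e \<subseteq> univ M"
    and F: "finite F" "\<And>\<phi>. \<phi> \<in> F \<Longrightarrow> lformula L \<phi>"
  obtains N :: "('f, 'r, nat) lstruct" and e' where
    "lstructure L N" "univ N \<noteq> {}" "range e' \<subseteq> univ N" "\<And>\<phi>. \<phi> \<in> F \<Longrightarrow> sat N e' \<phi> = sat M e \<phi>"
proof -
  define Sub where "Sub = (\<Union>\<phi>\<in>F. subfms \<phi>)"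
  define S where "S = (\<Union>\<phi>\<in>F. fm_funs \<phi>) \<inter> fsyms L"
  define c where "c = e 0"
  have c: "c \<in> univ M" using e by (auto simp: c_def)
  have finSub: "finite Sub" and finS: "finite S"
    using F by (auto simp: Sub_def S_def finite_subfms finite_fm_funs)
  have "finite (\<Union>\<phi>\<in>Sub. fv \<phi>)" using finSub by (auto simp: finite_fv)
  then obtain m where m: "\<And>\<phi> n. \<phi> \<in> Sub \<Longrightarrow> n \<in> fv \<phi> \<Longrightarrow> n < m"
    by (metis UN_iff finite_nat_set_iff_bounded)
  define asg where "asg ys n = (if n < length ys then ys ! n else c)" for ys :: "'a list" and n
  define op1 where "op1 f xs = (if length xs = farity L f \<and> set xs \<subseteq> univ M then fint M f xs else c)"
    for f xs
  define op2 where "op2 n b \<chi> ys = (if \<exists>a\<in>univ M. sat M ((asg ys)(n := a)) \<chi> = b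
      then SOME a. a \<in> univ M \<and> sat M ((asg ys)(n := a)) \<chi> = b else c)" for n b \<chi> ys
  define G where "G = op1 ` S \<union> (\<lambda>(n, b, \<chi>). op2 n b \<chi>) ` (UNIV \<times> UNIV \<times> Sub)"
  have op2: "op2 n b \<chi> ys \<in> univ M \<and>
      ((\<exists>a\<in>univ M. sat M ((asg ys)(n := a)) \<chi> = b) \<longrightarrow> sat M ((asg ys)(n := op2 n b \<chi> ys)) \<chi> = b)"
    for n b \<chi> ys
  proof (cases "\<exists>a\<in>univ M. sat M ((asg ys)(n := a)) \<chi> = b")
    case True
    then have "\<exists>a. a \<in> univ M \<and> sat M ((asg ys)(n := a)) \<chi> = b" by blast
    from someI_ex[OF this] show ?thesis using True by (simp add: op2_def)
  qed (auto simp: op2_def c)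
  have "countable G"
    unfolding G_def using finS finSub
    by (intro countable_Un countable_image countable_SIGMA) (auto intro: countable_finite)
  moreover have "g xs \<in> univ M" if "g \<in> G" "set xs \<subseteq> univ M" for g xs
    using that c M op2 by (auto simp: G_def op1_def S_def lstructure_def)
  ultimately obtain C where C: "countable C" "range e \<subseteq> C" "C \<subseteq> univ M"
    and C_closed: "\<And>g xs. g \<in> G \<Longrightarrow> set xs \<subseteq> C \<Longrightarrow> g xs \<in> C"
    using countable_closure[of G "univ M" "range e"] e by (metis countableI_type countable_image)
  have cC: "c \<in> C" using C by (auto simp: c_def)
  define g where "g = to_nat_on C"
  define h where "h = from_nat_into C"
  have hg[simp]: "h (g x) = x" if "x \<in> C" for x using that C by (simp add: g_def h_def)
  have mhg: "map h (map g xs) = xs" if "set xs \<subseteq> C" for xs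
    using that by (induction xs) auto
  define N where "N = \<lparr>univ = g ` C,
     fint = (\<lambda>f xs. if f \<in> S then g (fint M f (map h xs)) else g c),
     rint = (\<lambda>R xs. rint M R (map h xs))\<rparr>"
  have fC: "fint M f xs \<in> C" if "f \<in> S" "length xs = farity L f" "set xs \<subseteq> C" for f xs
    using C_closed[of "op1 f" xs] that C(3) by (auto simp: G_def op1_def split: if_splits)
  have N: "lstructure L N"
    unfolding lstructure_def
  proof (intro ballI allI impI, elim conjE)
    fix f xs assume a: "f \<in> fsyms L" "length xs = farity L f" "set xs \<subseteq> univ N"
    have "set (map h xs) \<subseteq> C" using a(3) by (auto simp: N_def)
    then show "fint N f xs \<in> univ N"
      using fC[of f "map h xs"] a(2) cC by (auto simp: N_def)
  qed
  have tmv: "tm_val M e1 t \<in> C \<and> tm_val N (g \<circ> e1) t = g (tm_val M e1 t)"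
    if "lterm L t" "tm_funs t \<subseteq> S" "range e1 \<subseteq> C" for t e1
  proof (rule tm_val_transfer[where S = S and L = L])
    fix f xs assume "f \<in> S" "length xs = farity L f" "set xs \<subseteq> C"
    then show "fint M f xs \<in> C \<and> fint N f (map g xs) = g (fint M f xs)"
      using fC[of f xs] mhg[of xs] by (simp add: N_def del: map_map)
  qed (use that in auto)
  have skolem: "\<exists>a\<in>C. sat M (e1(n := a)) \<chi> = b"
    if "\<chi> \<in> Sub" "range e1 \<subseteq> C" "\<exists>a\<in>univ M. sat M (e1(n := a)) \<chi> = b" for \<chi> e1 n b
  proof -
    define ys where "ys = map e1 [0..<m]"
    have ys: "set ys \<subseteq> C" using that(2) by (auto simp: ys_def)
    have eq: "sat M (e1(n := a)) \<chi> = sat M ((asg ys)(n := a)) \<chi>" for a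
      by (rule sat_cong) (use m[OF that(1)] in \<open>auto simp: asg_def ys_def\<close>)
    have "op2 n b \<chi> ys \<in> C"
      using C_closed[OF _ ys, of "op2 n b \<chi>"] that(1) by (force simp: G_def)
    moreover have "sat M (e1(n := op2 n b \<chi> ys)) \<chi> = b"
      using op2[of n b \<chi> ys] that(3) by (simp add: eq)
    ultimately show ?thesis by blast
  qed
  have main: "sat N (g \<circ> e1) \<phi> = sat M e1 \<phi>"
    if "subfms \<phi> \<subseteq> Sub" "lformula L \<phi>" "fm_funs \<phi> \<subseteq> S" "range e1 \<subseteq> C" for \<phi> e1
    using that
  proof (induction \<phi> arbitrary: e1)
    case (Eq s t)
    have 1: "tm_val M e1 s \<in> C \<and> tm_val N (g \<circ> e1) s = g (tm_val M e1 s)"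
      and 2: "tm_val M e1 t \<in> C \<and> tm_val N (g \<circ> e1) t = g (tm_val M e1 t)"
      using Eq by (simp_all add: tmv)
    then have "g (tm_val M e1 s) = g (tm_val M e1 t) \<longleftrightarrow> tm_val M e1 s = tm_val M e1 t"
      by (metis hg)
    then show ?case using 1 2 by (simp add: comp_def)
  next
    case (Rel R ts)
    have 1: "tm_val M e1 t \<in> C \<and> tm_val N (g \<circ> e1) t = g (tm_val M e1 t)" if "t \<in> set ts" for t
      using Rel that by (intro tmv) auto
    then have "map (h \<circ> tm_val N (g \<circ> e1)) ts = map (tm_val M e1) ts"
      by (intro map_cong) auto
    then show ?case by (simp add: N_def comp_def cong: map_cong)
  next
    case (Ex n \<phi>)
    have sub: "\<phi> \<in> Sub" using Ex.prems self_in_subfms[of \<phi>] by auto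
    have IH: "sat N ((g \<circ> e1)(n := g a)) \<phi> = sat M (e1(n := a)) \<phi>" if "a \<in> C" for a
    proof -
      have "sat N (g \<circ> e1(n := a)) \<phi> = sat M (e1(n := a)) \<phi>"
        using Ex that by (intro Ex.IH) (auto simp: image_subset_iff)
      then show ?thesis by (simp add: fun_upd_comp)
    qed
    have "sat N (g \<circ> e1) (Ex n \<phi>) \<longleftrightarrow> (\<exists>a\<in>C. sat M (e1(n := a)) \<phi>)"
      using IH by (simp add: N_def)
    also have "\<dots> \<longleftrightarrow> (\<exists>a\<in>univ M. sat M (e1(n := a)) \<phi>)"
      using skolem[OF sub Ex.prems(4), of n True] C(3) by auto
    finally show ?case by (simp add: comp_def)
  next
    case (All n \<phi>)
    have sub: "\<phi> \<in> Sub" using All.prems self_in_subfms[of \<phi>] by auto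
    have IH: "sat N ((g \<circ> e1)(n := g a)) \<phi> = sat M (e1(n := a)) \<phi>" if "a \<in> C" for a
    proof -
      have "sat N (g \<circ> e1(n := a)) \<phi> = sat M (e1(n := a)) \<phi>"
        using All that by (intro All.IH) (auto simp: image_subset_iff)
      then show ?thesis by (simp add: fun_upd_comp)
    qed
    have "sat N (g \<circ> e1) (All n \<phi>) \<longleftrightarrow> (\<forall>a\<in>C. sat M (e1(n := a)) \<phi>)"
      using IH by (simp add: N_def)
    also have "\<dots> \<longleftrightarrow> (\<forall>a\<in>univ M. sat M (e1(n := a)) \<phi>)"
      using skolem[OF sub All.prems(4), of n False] C(3) by auto
    finally show ?case by (simp add: comp_def)
  qed auto
  have funs: "fm_funs \<phi> \<subseteq> S" if "\<phi> \<in> F" for \<phi>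
  proof -
    have t: "lterm L t \<Longrightarrow> tm_funs t \<subseteq> fsyms L" for t :: "'f tm"
      by (induction t) auto
    have "lformula L \<psi> \<Longrightarrow> fm_funs \<psi> \<subseteq> fsyms L" for \<psi> :: "('f, 'r) fm"
      by (induction \<psi>) (use t in auto)
    then show ?thesis using that F by (auto simp: S_def)
  qed
  show thesis
  proof (rule that[of N "g \<circ> e"])
    show "univ N \<noteq> {}" using cC by (auto simp: N_def)
    show "range (g \<circ> e) \<subseteq> univ N" using C by (auto simp: N_def)
    show "sat N (g \<circ> e) \<phi> = sat M e \<phi>" if "\<phi> \<in> F" for \<phi>
      using that F C funs by (intro main) (auto simp: Sub_def)
  qed (rule N)
qed

theorem logically_equivalentD:
  fixes M :: "('f, 'r, 'a) lstruct"
  assumes "logically_equivalent L \<phi> \<psi>" "lformula L \<phi>" "lformula L \<psi>"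
    and "lstructure L M" "range e \<subseteq> univ M"
  shows "sat M e \<phi> = sat M e \<psi>"
proof -
  obtain N :: "('f, 'r, nat) lstruct" and e' where N: "lstructure L N" "univ N \<noteq> {}"
    "range e' \<subseteq> univ N" and eq: "\<And>\<chi>. \<chi> \<in> {\<phi>, \<psi>} \<Longrightarrow> sat N e' \<chi> = sat M e \<chi>"
    by (rule countable_model[of L M e "{\<phi>, \<psi>}"]) (use assms in auto)
  have "sat N e' \<phi> = sat N e' \<psi>"
    using assms(1) N unfolding logically_equivalent_def by blast
  then show ?thesis using eq by simp
qed


section \<open>Limits of diagrams over downward directed posets\<close>

text \<open>A partial order \<open>r\<close> on \<open>I\<close> is given as a set of pairs, \<open>(i, j) \<in> r\<close> meaning \<open>i \<le> j\<close>.\<close>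

definition downward_directed :: "'i set \<Rightarrow> 'i rel \<Rightarrow> bool" where
  "downward_directed I r \<longleftrightarrow>
    partial_order_on I r \<and> I \<noteq> {} \<and> (\<forall>i\<in>I. \<forall>j\<in>I. \<exists>k\<in>I. (k, i) \<in> r \<and> (k, j) \<in> r)"

text \<open>A functor from the poset to the category of structures: \<open>d i j : D i \<rightarrow> D j\<close> for \<open>i \<le> j\<close>.\<close>

definition diagram :: "('f, 'r) language \<Rightarrow> 'i set \<Rightarrow> 'i rel \<Rightarrow> ('i \<Rightarrow> ('f, 'r, 'a) lstruct) \<Rightarrow>
    ('i \<Rightarrow> 'i \<Rightarrow> 'a \<Rightarrow> 'a) \<Rightarrow> bool" where
  "diagram L I r D d \<longleftrightarrow>
    (\<forall>i\<in>I. lstructure L (D i)) \<and>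
    (\<forall>(i, j)\<in>r. lhom L (D i) (D j) (d i j)) \<and>
    (\<forall>i\<in>I. \<forall>x\<in>univ (D i). d i i x = x) \<and>
    (\<forall>i j k. (i, j) \<in> r \<and> (j, k) \<in> r \<longrightarrow> (\<forall>x\<in>univ (D i). d j k (d i j x) = d i k x))"

definition cone :: "('f, 'r) language \<Rightarrow> 'i set \<Rightarrow> 'i rel \<Rightarrow> ('i \<Rightarrow> ('f, 'r, 'a) lstruct) \<Rightarrow>
    ('i \<Rightarrow> 'i \<Rightarrow> 'a \<Rightarrow> 'a) \<Rightarrow> ('f, 'r, 'q) lstruct \<Rightarrow> ('i \<Rightarrow> 'q \<Rightarrow> 'a) \<Rightarrow> bool" where
  "cone L I r D d Q \<rho> \<longleftrightarrow>
    lstructure L Q \<and>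
    (\<forall>i\<in>I. lhom L Q (D i) (\<rho> i)) \<and>
    (\<forall>(i, j)\<in>r. \<forall>x\<in>univ Q. d i j (\<rho> i x) = \<rho> j x)"

definition factors_uniquely :: "('f, 'r) language \<Rightarrow> 'i set \<Rightarrow> ('f, 'r, 'p) lstruct \<Rightarrow> ('i \<Rightarrow> 'p \<Rightarrow> 'a) \<Rightarrow>
    ('f, 'r, 'q) lstruct \<Rightarrow> ('i \<Rightarrow> 'q \<Rightarrow> 'a) \<Rightarrow> bool" where
  "factors_uniquely L I P \<pi> Q \<rho> \<longleftrightarrow>
    (\<exists>h. lhom L Q P h \<and> (\<forall>i\<in>I. \<forall>x\<in>univ Q. \<pi> i (h x) = \<rho> i x)) \<and>
    (\<forall>h h'. lhom L Q P h \<and> (\<forall>i\<in>I. \<forall>x\<in>univ Q. \<pi> i (h x) = \<rho> i x) \<and>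
       lhom L Q P h' \<and> (\<forall>i\<in>I. \<forall>x\<in>univ Q. \<pi> i (h' x) = \<rho> i x) \<longrightarrow>
       (\<forall>x\<in>univ Q. h x = h' x))"

text \<open>The universal property is tested on structures with elements of type \<^typ>\<open>'p + ('i \<Rightarrow> 'a)\<close>. This
  type has room for a copy of the apex and for a copy of the structure of compatible families, and
  therefore the property extends to structures over all types (\<open>limit_cone_universal\<close> below).\<close>

definition limit_cone :: "('f, 'r) language \<Rightarrow> 'i set \<Rightarrow> 'i rel \<Rightarrow> ('i \<Rightarrow> ('f, 'r, 'a) lstruct) \<Rightarrow>
    ('i \<Rightarrow> 'i \<Rightarrow> 'a \<Rightarrow> 'a) \<Rightarrow> ('f, 'r, 'p) lstruct \<Rightarrow> ('i \<Rightarrow> 'p \<Rightarrow> 'a) \<Rightarrow> bool" where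
  "limit_cone L I r D d P \<pi> \<longleftrightarrow>
    cone L I r D d P \<pi> \<and>
    (\<forall>(Q :: ('f, 'r, 'p + ('i \<Rightarrow> 'a)) lstruct) \<rho>. cone L I r D d Q \<rho> \<longrightarrow> factors_uniquely L I P \<pi> Q \<rho>)"


subsection \<open>Existence of limits, and the universal property over arbitrary types\<close>

definition families :: "'i set \<Rightarrow> 'i rel \<Rightarrow> ('i \<Rightarrow> ('f, 'r, 'a) lstruct) \<Rightarrow> ('i \<Rightarrow> 'i \<Rightarrow> 'a \<Rightarrow> 'a) \<Rightarrow>
    ('f, 'r, 'i \<Rightarrow> 'a) lstruct" where
  "families I r D d = \<lparr>
     univ = {x \<in> Pi\<^sub>E I (\<lambda>i. univ (D i)). \<forall>(i, j)\<in>r. d i j (x i) = x j},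
     fint = (\<lambda>f xs. \<lambda>i\<in>I. fint (D i) f (map (\<lambda>x. x i) xs)),
     rint = (\<lambda>R xs. \<forall>i\<in>I. rint (D i) R (map (\<lambda>x. x i) xs))\<rparr>"

lemma lhom_comp:
  assumes "lhom L M N h" "lhom L N K k" shows "lhom L M K (k \<circ> h)"
proof -
  have s: "set (map h xs) \<subseteq> univ N" if "set xs \<subseteq> univ M" for xs
    using that assms(1) by (auto simp: lhom_def)
  show ?thesis
    unfolding lhom_def
  proof (intro conjI ballI allI impI; (elim conjE)?)
    fix f xs assume "f \<in> fsyms L" "length xs = farity L f" "set xs \<subseteq> univ M"
    then show "(k \<circ> h) (fint M f xs) = fint K f (map (k \<circ> h) xs)"
      using assms s[of xs] by (simp add: lhom_def)
  next
    fix R xs assume "R \<in> rsyms L" "length xs = rarity L R" "set xs \<subseteq> univ M" "rint M R xs"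
    then have "rint K R (map k (map h xs))"
      using assms s[of xs] by (simp add: lhom_def del: map_map)
    then show "rint K R (map (k \<circ> h) xs)" by simp
  qed (use assms in \<open>auto simp: lhom_def\<close>)
qed

lemma cone_comp:
  assumes "cone L I r D d P \<pi>" "lstructure L Q" "lhom L Q P h"
  shows "cone L I r D d Q (\<lambda>i. \<pi> i \<circ> h)"
  using assms lhom_comp[OF assms(3)] by (auto simp: cone_def lhom_def[of _ Q P])

lemma families_cone:
  assumes "diagram L I r D d" "r \<subseteq> I \<times> I"
  shows "cone L I r D d (families I r D d) (\<lambda>i x. x i)"
proof -
  have mem: "(\<lambda>i\<in>I. fint (D i) f (map (\<lambda>x. x i) xs)) \<in> univ (families I r D d)"
    if f: "f \<in> fsyms L" "length xs = farity L f" and xs: "set xs \<subseteq> univ (families I r D d)" for f xs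
  proof -
    have s: "set (map (\<lambda>x. x i) xs) \<subseteq> univ (D i)" if "i \<in> I" for i
      using xs that by (auto simp: families_def PiE_iff subset_iff)
    have "d i j (fint (D i) f (map (\<lambda>x. x i) xs)) = fint (D j) f (map (\<lambda>x. x j) xs)"
      if "(i, j) \<in> r" for i j
    proof -
      have h: "lhom L (D i) (D j) (d i j)" and i: "i \<in> I" using assms that by (auto simp: diagram_def)
      have "d i j (fint (D i) f (map (\<lambda>x. x i) xs)) = fint (D j) f (map (d i j) (map (\<lambda>x. x i) xs))"
        using h f s[OF i] by (auto simp: lhom_def simp del: map_map)
      also have "map (d i j) (map (\<lambda>x. x i) xs) = map (\<lambda>x. x j) xs"
        using xs that by (auto simp: families_def subset_iff)
      finally show ?thesis .
    qed
    moreover have "fint (D i) f (map (\<lambda>x. x i) xs) \<in> univ (D i)" if "i \<in> I" for i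
      using assms(1) s[OF that] that f by (auto simp: diagram_def lstructure_def)
    ultimately show ?thesis using assms(2) by (auto simp: families_def)
  qed
  have "lstructure L (families I r D d)"
    unfolding lstructure_def using mem by (simp add: families_def)
  moreover have "lhom L (families I r D d) (D i) (\<lambda>x. x i)" if "i \<in> I" for i
    using that by (auto simp: lhom_def families_def)
  moreover have "\<forall>(i, j)\<in>r. \<forall>x\<in>univ (families I r D d). d i j (x i) = x j"
    by (auto simp: families_def)
  ultimately show ?thesis by (simp add: cone_def)
qed

lemma families_factor:
  assumes "cone L I r D d Q \<rho>" "r \<subseteq> I \<times> I"
  shows "lhom L Q (families I r D d) (\<lambda>x. \<lambda>i\<in>I. \<rho> i x)"
proof -
  have h: "lhom L Q (D i) (\<rho> i)" if "i \<in> I" for i using assms that by (auto simp: cone_def)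
  have m: "map ((\<lambda>y. y i) \<circ> (\<lambda>x. \<lambda>i\<in>I. \<rho> i x)) xs = map (\<rho> i) xs" if "i \<in> I" for i xs
    using that by simp
  show ?thesis
    unfolding lhom_def
  proof (intro conjI ballI allI impI; (elim conjE)?)
    fix x assume "x \<in> univ Q"
    then show "(\<lambda>i\<in>I. \<rho> i x) \<in> univ (families I r D d)"
      using assms h by (auto simp: families_def lhom_def cone_def subset_iff)
  next
    fix f xs assume "f \<in> fsyms L" "length xs = farity L f" "set xs \<subseteq> univ Q"
    then have "\<rho> i (fint Q f xs) = fint (D i) f (map (\<rho> i) xs)" if "i \<in> I" for i
      using h[OF that] by (simp add: lhom_def)
    then show "(\<lambda>i\<in>I. \<rho> i (fint Q f xs)) = fint (families I r D d) f (map (\<lambda>x. \<lambda>i\<in>I. \<rho> i x) xs)"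
      by (auto simp: families_def m fun_eq_iff)
  next
    fix R xs assume "R \<in> rsyms L" "length xs = rarity L R" "set xs \<subseteq> univ Q" "rint Q R xs"
    then have "rint (D i) R (map (\<rho> i) xs)" if "i \<in> I" for i
      using h[OF that] by (simp add: lhom_def)
    then show "rint (families I r D d) R (map (\<lambda>x. \<lambda>i\<in>I. \<rho> i x) xs)"
      by (auto simp: families_def m)
  qed
qed

lemma families_factors_uniquely:
  assumes "cone L I r D d Q \<rho>" "r \<subseteq> I \<times> I"
  shows "factors_uniquely L I (families I r D d) (\<lambda>i x. x i) Q \<rho>"
  unfolding factors_uniquely_def
proof (intro conjI allI impI ballI; (elim conjE)?)
  show "\<exists>h. lhom L Q (families I r D d) h \<and> (\<forall>i\<in>I. \<forall>x\<in>univ Q. h x i = \<rho> i x)"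
    using families_factor[OF assms] by (intro exI[of _ "\<lambda>x. \<lambda>i\<in>I. \<rho> i x"]) auto
next
  fix h h' x
  assume h: "lhom L Q (families I r D d) h" "lhom L Q (families I r D d) h'"
    and eq: "\<forall>i\<in>I. \<forall>x\<in>univ Q. h x i = \<rho> i x" "\<forall>i\<in>I. \<forall>x\<in>univ Q. h' x i = \<rho> i x"
    and x: "x \<in> univ Q"
  have "h x \<in> extensional I" "h' x \<in> extensional I"
    using h x by (auto simp: lhom_def families_def PiE_iff)
  then show "h x = h' x" using eq x by (intro extensionalityI) auto
qed

theorem families_limit_cone:
  assumes "diagram L I r D d" "r \<subseteq> I \<times> I"
  shows "limit_cone L I r D d (families I r D d) (\<lambda>i x. x i)"
  unfolding limit_cone_def
  using families_cone[OF assms] families_factors_uniquely[OF _ assms(2)] by blast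

definition copy :: "('a \<Rightarrow> 'b) \<Rightarrow> ('b \<Rightarrow> 'a) \<Rightarrow> ('f, 'r, 'a) lstruct \<Rightarrow> ('f, 'r, 'b) lstruct" where
  "copy g k M = \<lparr>univ = g ` univ M, fint = (\<lambda>f xs. g (fint M f (map k xs))),
     rint = (\<lambda>R xs. rint M R (map k xs))\<rparr>"

lemma copy:
  assumes "\<And>x. k (g x) = x" "lstructure L M"
  shows "lstructure L (copy g k M)" "lhom L M (copy g k M) g" "lhom L (copy g k M) M k"
proof -
  have "set (map k xs) \<subseteq> univ M" if "set xs \<subseteq> g ` univ M" for xs
    using that assms(1) by auto
  then show "lstructure L (copy g k M)"
    using assms(2) by (fastforce simp: lstructure_def copy_def)
  have "k \<circ> g = id" using assms(1) by auto
  then show "lhom L M (copy g k M) g" by (auto simp: lhom_def copy_def)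
  show "lhom L (copy g k M) M k" using assms(1) by (auto simp: lhom_def copy_def)
qed

lemma factors_uniquely_copy:
  assumes kg: "\<And>x. k (g x) = x" and Q: "lstructure L Q"
    and fu: "factors_uniquely L I P \<pi> (copy g k Q) (\<lambda>i. \<rho> i \<circ> k)"
  shows "factors_uniquely L I P \<pi> Q \<rho>"
  unfolding factors_uniquely_def
proof (intro conjI allI impI ballI; (elim conjE)?)
  obtain h where "lhom L (copy g k Q) P h"
    and eq: "\<forall>i\<in>I. \<forall>x\<in>univ (copy g k Q). \<pi> i (h x) = \<rho> i (k x)"
    using fu by (auto simp: factors_uniquely_def)
  then have "lhom L Q P (h \<circ> g)" using lhom_comp copy(2)[of k g, OF kg Q] by blast
  moreover have "\<forall>i\<in>I. \<forall>x\<in>univ Q. \<pi> i ((h \<circ> g) x) = \<rho> i x"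
    using eq by (auto simp: copy_def kg)
  ultimately show "\<exists>h. lhom L Q P h \<and> (\<forall>i\<in>I. \<forall>x\<in>univ Q. \<pi> i (h x) = \<rho> i x)" by blast
next
  fix h h' x
  assume h: "lhom L Q P h" "lhom L Q P h'"
    and eq: "\<forall>i\<in>I. \<forall>x\<in>univ Q. \<pi> i (h x) = \<rho> i x" "\<forall>i\<in>I. \<forall>x\<in>univ Q. \<pi> i (h' x) = \<rho> i x"
    and x: "x \<in> univ Q"
  have "lhom L (copy g k Q) P (h \<circ> k)" "lhom L (copy g k Q) P (h' \<circ> k)"
    using lhom_comp[OF copy(3)[of k g, OF kg Q]] h by blast+
  moreover have "\<forall>i\<in>I. \<forall>x\<in>univ (copy g k Q). \<pi> i ((h \<circ> k) x) = (\<rho> i \<circ> k) x"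
    "\<forall>i\<in>I. \<forall>x\<in>univ (copy g k Q). \<pi> i ((h' \<circ> k) x) = (\<rho> i \<circ> k) x"
    using eq by (auto simp: copy_def kg)
  ultimately have "\<forall>y\<in>univ (copy g k Q). (h \<circ> k) y = (h' \<circ> k) y"
    using fu unfolding factors_uniquely_def by blast
  then show "h x = h' x" using x by (auto simp: copy_def kg)
qed

lemma limit_cone_factors_left:
  fixes P :: "('f, 'r, 'p) lstruct" and D :: "'i \<Rightarrow> ('f, 'r, 'a) lstruct"
  assumes "limit_cone L I r D d P \<pi>" "cone L I r D d (Q :: ('f, 'r, 'p) lstruct) \<rho>"
  shows "factors_uniquely L I P \<pi> Q \<rho>"
proof (rule factors_uniquely_copy[where k = projl and g = Inl])
  let ?g = "Inl :: 'p \<Rightarrow> 'p + ('i \<Rightarrow> 'a)"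
  have Q: "lstructure L Q" using assms by (simp add: cone_def)
  show "projl (?g x) = x" for x by simp
  show "lstructure L Q" by (rule Q)
  have "cone L I r D d (copy ?g projl Q) (\<lambda>i. \<rho> i \<circ> projl)"
    using cone_comp[OF assms(2) copy(1,3)[of projl ?g L Q]] Q by simp
  then show "factors_uniquely L I P \<pi> (copy ?g projl Q) (\<lambda>i. \<rho> i \<circ> projl)"
    using assms(1) by (simp add: limit_cone_def)
qed

lemma limit_cone_factors_right:
  fixes P :: "('f, 'r, 'p) lstruct" and D :: "'i \<Rightarrow> ('f, 'r, 'a) lstruct"
  assumes "limit_cone L I r D d P \<pi>" "cone L I r D d (Q :: ('f, 'r, 'i \<Rightarrow> 'a) lstruct) \<rho>"
  shows "factors_uniquely L I P \<pi> Q \<rho>"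
proof (rule factors_uniquely_copy[where k = projr and g = Inr])
  let ?g = "Inr :: ('i \<Rightarrow> 'a) \<Rightarrow> 'p + ('i \<Rightarrow> 'a)"
  have Q: "lstructure L Q" using assms by (simp add: cone_def)
  show "projr (?g x) = x" for x by simp
  show "lstructure L Q" by (rule Q)
  have "cone L I r D d (copy ?g projr Q) (\<lambda>i. \<rho> i \<circ> projr)"
    using cone_comp[OF assms(2) copy(1,3)[of projr ?g L Q]] Q by simp
  then show "factors_uniquely L I P \<pi> (copy ?g projr Q) (\<lambda>i. \<rho> i \<circ> projr)"
    using assms(1) by (simp add: limit_cone_def)
qed

lemma lhom_id: "lhom L M M (\<lambda>x. x)"
  by (simp add: lhom_def)

theorem limit_cone_iso_families:
  fixes P :: "('f, 'r, 'p) lstruct"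
  assumes lim: "limit_cone L I r D d P \<pi>" and dia: "diagram L I r D d" and r: "r \<subseteq> I \<times> I"
  obtains u where "lhom L (families I r D d) P u" "lhom L P (families I r D d) (\<lambda>x. \<lambda>i\<in>I. \<pi> i x)"
    "\<And>x. x \<in> univ P \<Longrightarrow> u (\<lambda>i\<in>I. \<pi> i x) = x"
    "\<And>y. y \<in> univ (families I r D d) \<Longrightarrow> (\<lambda>i\<in>I. \<pi> i (u y)) = y"
proof -
  let ?C = "families I r D d" and ?v = "\<lambda>x. \<lambda>i\<in>I. \<pi> i x"
  have cP: "cone L I r D d P \<pi>" using lim by (simp add: limit_cone_def)
  have v: "lhom L P ?C ?v" using families_factor[OF cP r] .
  obtain u where u: "lhom L ?C P u" and pu: "\<And>i y. i \<in> I \<Longrightarrow> y \<in> univ ?C \<Longrightarrow> \<pi> i (u y) = y i"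
    using limit_cone_factors_right[OF lim families_cone[OF dia r]]
    unfolding factors_uniquely_def by blast
  have "?v (u y) = y" if "y \<in> univ ?C" for y
  proof -
    have "y \<in> extensional I" using that by (auto simp: families_def PiE_iff)
    then show ?thesis using pu that by (intro extensionalityI[of _ I]) auto
  qed
  moreover have "u (?v x) = x" if "x \<in> univ P" for x
  proof -
    have "lhom L P P (u \<circ> ?v)" using lhom_comp[OF v u] .
    moreover have "\<forall>i\<in>I. \<forall>x\<in>univ P. \<pi> i ((u \<circ> ?v) x) = \<pi> i x"
    proof (intro ballI)
      fix i x assume "i \<in> I" "x \<in> univ P"
      moreover from this have "?v x \<in> univ ?C" using v by (auto simp: lhom_def)
      ultimately show "\<pi> i ((u \<circ> ?v) x) = \<pi> i x" using pu[of i "?v x"] by simp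
    qed
    ultimately have "\<forall>x\<in>univ P. (u \<circ> ?v) x = (\<lambda>x. x) x"
      using limit_cone_factors_left[OF lim cP] lhom_id[of L P]
      unfolding factors_uniquely_def by blast
    then show ?thesis using that by simp
  qed
  ultimately show thesis using that u v by blast
qed

theorem limit_cone_universal:
  fixes P :: "('f, 'r, 'p) lstruct" and Q :: "('f, 'r, 'q) lstruct"
  assumes lim: "limit_cone L I r D d P \<pi>" and dia: "diagram L I r D d" and r: "r \<subseteq> I \<times> I"
    and Q: "cone L I r D d Q \<rho>"
  shows "factors_uniquely L I P \<pi> Q \<rho>"
proof -
  let ?C = "families I r D d" and ?v = "\<lambda>x. \<lambda>i\<in>I. \<pi> i x"
  obtain u where u: "lhom L ?C P u" and vu: "\<And>x. x \<in> univ P \<Longrightarrow> u (?v x) = x"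
    and uv: "\<And>y. y \<in> univ ?C \<Longrightarrow> ?v (u y) = y"
    using limit_cone_iso_families[OF lim dia r] by blast
  show ?thesis
    unfolding factors_uniquely_def
  proof (intro conjI allI impI ballI; (elim conjE)?)
    let ?k = "\<lambda>x. \<lambda>i\<in>I. \<rho> i x"
    have k: "lhom L Q ?C ?k" using families_factor[OF Q r] .
    have "\<pi> i (u (?k x)) = \<rho> i x" if "i \<in> I" "x \<in> univ Q" for i x
    proof -
      have "?k x \<in> univ ?C" using k that by (auto simp: lhom_def)
      from fun_cong[OF uv[OF this], of i] show ?thesis using that by simp
    qed
    then show "\<exists>h. lhom L Q P h \<and> (\<forall>i\<in>I. \<forall>x\<in>univ Q. \<pi> i (h x) = \<rho> i x)"
      using lhom_comp[OF k u] by (intro exI[of _ "u \<circ> ?k"]) auto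
  next
    fix h h' x
    assume h: "lhom L Q P h" "lhom L Q P h'"
      and eq: "\<forall>i\<in>I. \<forall>x\<in>univ Q. \<pi> i (h x) = \<rho> i x" "\<forall>i\<in>I. \<forall>x\<in>univ Q. \<pi> i (h' x) = \<rho> i x"
      and x: "x \<in> univ Q"
    have "?v (h x) = ?v (h' x)" using eq x by auto
    moreover have "h x \<in> univ P" "h' x \<in> univ P" using h x by (auto simp: lhom_def)
    ultimately show "h x = h' x" using vu by metis
  qed
qed

end

theory Submission
  imports Defs "HOL-Analysis.Function_Topology"
begin

text \<open>An existential positive formula holds in a limit of finite structures at a tuple iff it holds in
  every structure of the diagram at the image of that tuple: for a disjunction one uses that the
  poset is directed, and for \<open>\<exists>x\<close> that the nonempty finite sets of witnesses form an inverse system,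
  whose limit is nonempty by compactness. Hence the implications between such formulas pass to the
  limit. Since formulas in \<open>\<exists>\<^sup>+(L)\<close> agree with existential positive ones only over nonempty universes,
  an empty limit is treated apart: by compactness some structure of the diagram is then empty as
  well, and over empty universes a sentence depends only on finitely many relations of arity 0,
  on which the limit agrees with all sufficiently low structures of the diagram.\<close>

section \<open>Inverse systems of nonempty finite sets\<close>

lemma downward_directed_finite_lower_bound:
  assumes "downward_directed I r" "finite F" "F \<subseteq> I"
  shows "\<exists>k\<in>I. \<forall>i\<in>F. (k, i) \<in> r"
  using assms(2,3)
proof (induction F)
  case empty
  then show ?case using assms(1) by (auto simp: downward_directed_def)
next
  case (insert i F)
  then obtain k where k: "k \<in> I" "\<forall>i\<in>F. (k, i) \<in> r" by auto
  have "i \<in> I" using insert.prems by simp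
  then obtain l where l: "l \<in> I" "(l, k) \<in> r" "(l, i) \<in> r"
    using assms(1) k unfolding downward_directed_def by blast
  have "trans r" using assms(1) by (auto simp: downward_directed_def partial_order_on_def preorder_on_def)
  then have "(l, j) \<in> r" if "j \<in> F" for j using k(2) l(2) that by (blast dest: transD)
  then show ?case using l by blast
qed

text \<open>By Tychonoff's theorem the product of the finite discrete spaces \<open>A i\<close> is
  compact. Each compatibility condition cuts out a closed set, and finitely many of them hold
  together at a family pushed up from a common lower bound, so the finite intersection property
  applies.\<close>

theorem inverse_limit_nonempty:
  assumes dir: "downward_directed I r"
    and fin: "\<And>i. i \<in> I \<Longrightarrow> finite (A i)" and ne: "\<And>i. i \<in> I \<Longrightarrow> A i \<noteq> {}"
    and maps: "\<And>i j a. (i, j) \<in> r \<Longrightarrow> a \<in> A i \<Longrightarrow> d i j a \<in> A j"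
    and comp: "\<And>i j k a. (i, j) \<in> r \<Longrightarrow> (j, k) \<in> r \<Longrightarrow> a \<in> A i \<Longrightarrow> d j k (d i j a) = d i k a"
  shows "\<exists>x\<in>Pi\<^sub>E I A. \<forall>(i, j)\<in>r. d i j (x i) = x j"
proof (cases "r = {}")
  \<comment> \<open>For empty \<open>r\<close> the intersection of the sets \<open>E p\<close> would
    be the whole type; otherwise some \<open>E p\<close> keeps the point inside the product.\<close>
  case True
  then show ?thesis using ne by (auto simp: PiE_eq_empty_iff ex_in_conv)
next
  case False
  have r: "r \<subseteq> I \<times> I"
    using dir by (auto simp: downward_directed_def partial_order_on_def preorder_on_def)
  let ?X = "product_topology (\<lambda>i. discrete_topology (A i)) I"
  define E where "E = (\<lambda>(i, j). {x \<in> Pi\<^sub>E I A. d i j (x i) = x j})"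
  have top: "topspace ?X = Pi\<^sub>E I A" by (simp add: topspace_product_topology)
  have compact: "compact_space ?X"
    using fin by (simp add: compact_space_product_topology compact_space_discrete_topology)
  have closed: "closedin ?X (E p)" if "p \<in> r" for p
  proof -
    obtain i j where "p = (i, j)" by (cases p)
    then have p: "p = (i, j)" "(i, j) \<in> r" "i \<in> I" "j \<in> I" using that r by auto
    have coord: "closedin ?X {x \<in> topspace ?X. x k \<in> {a}}" if "k \<in> I" "a \<in> A k" for k a
      by (rule closedin_continuous_map_preimage[OF continuous_map_product_projection])
        (use that in auto)
    \<comment> \<open>Sorting by the value \<open>a\<close> of \<open>x i\<close> writes
      \<open>E (i, j)\<close> as a union, finite because \<open>A i\<close> is, of intersections of
      two closed coordinate conditions.\<close>
    define S where "S a = {x \<in> topspace ?X. x i \<in> {a}} \<inter> {x \<in> topspace ?X. x j \<in> {d i j a}}" for a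
    have "closedin ?X (S a)" if "a \<in> A i" for a
      unfolding S_def by (rule closedin_Int[OF coord[OF p(3) that] coord[OF p(4) maps[OF p(2) that]]])
    then have "closedin ?X (\<Union>(S ` A i))"
      by (intro closedin_Union finite_imageI fin[OF p(3)]) auto
    moreover have "E p = \<Union>(S ` A i)"
      unfolding p(1) E_def S_def top using PiE_mem[OF _ p(3), of _ A] by auto
    ultimately show ?thesis by simp
  qed
  have fip: "\<Inter>\<F> \<noteq> {}" if \<F>: "finite \<F>" "\<F> \<subseteq> E ` r" for \<F>
  proof -
    obtain Q where Q: "finite Q" "Q \<subseteq> r" "\<F> = E ` Q"
      using finite_subset_image[OF \<F>] by auto
    obtain k where k: "k \<in> I" "\<And>p. p \<in> Q \<Longrightarrow> (k, fst p) \<in> r \<and> (k, snd p) \<in> r"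
    proof -
      have "finite (fst ` Q \<union> snd ` Q)" "fst ` Q \<union> snd ` Q \<subseteq> I" using Q r by auto
      from downward_directed_finite_lower_bound[OF dir this] show thesis using that by blast
    qed
    obtain a where a: "a \<in> A k" using ne k by blast
    \<comment> \<open>The conditions in \<open>Q\<close> involve only indices above
      \<open>k\<close>; there the family consists of images of \<open>a\<close>, elsewhere it is
      arbitrary.\<close>
    define x where "x = (\<lambda>i\<in>I. if (k, i) \<in> r then d k i a else (SOME b. b \<in> A i))"
    have "x \<in> Pi\<^sub>E I A"
      using maps[OF _ a] ne by (simp add: x_def some_in_eq)
    moreover have "d i j (x i) = x j" if "(i, j) \<in> Q" for i j
    proof -
      have ij: "(i, j) \<in> r" "i \<in> I" "j \<in> I" using that Q(2) r by auto
      then have "x i = d k i a" "x j = d k j a" using k(2)[OF that] by (simp_all add: x_def)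
      then show ?thesis using comp[OF _ ij(1) a] k(2)[OF that] by simp
    qed
    ultimately have "x \<in> E p" if "p \<in> Q" for p
      using that by (cases p) (simp add: E_def)
    then have "x \<in> \<Inter>\<F>" by (simp add: Q(3))
    then show ?thesis by blast
  qed
  have "\<Inter>(E ` r) \<noteq> {}"
    by (rule compact_space_fip[THEN iffD1, OF compact, rule_format])
      (use closed fip in blast)
  then obtain x where x: "\<And>p. p \<in> r \<Longrightarrow> x \<in> E p" by blast
  then have "x \<in> Pi\<^sub>E I A" using False by (auto simp: E_def)
  moreover have "d i j (x i) = x j" if "(i, j) \<in> r" for i j using x[OF that] by (simp add: E_def)
  ultimately show ?thesis by blast
qed

section \<open>Satisfaction along homomorphisms, quantifier prefixes and closed terms\<close>

lemma tm_val_lhom: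
  assumes "lhom L M N h" "lstructure L M" "range e \<subseteq> univ M" "lterm L t"
  shows "tm_val N (h \<circ> e) t = h (tm_val M e t)"
proof -
  have "lterm L t \<Longrightarrow> tm_funs t \<subseteq> fsyms L" for t :: "'a tm"
    by (induction t) auto
  then show ?thesis
    using tm_val_transfer[of "fsyms L" L "univ M" M N h t e] assms
    by (simp add: lhom_def lstructure_def)
qed

lemma range_fun_upd: "range e \<subseteq> A \<Longrightarrow> a \<in> A \<Longrightarrow> range (e(n := a)) \<subseteq> A"
  by auto

text \<open>Homomorphisms preserve atomic formulas and send witnesses to witnesses. The assignment
  must stay in the universe, since only there does \<open>lhom\<close> constrain the map.\<close>

lemma ex_pos_lhom:
  assumes h: "lhom L M N h" and M: "lstructure L M"
    and "ex_pos \<phi>" "lformula L \<phi>" "range e \<subseteq> univ M" "sat M e \<phi>"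
  shows "sat N (h \<circ> e) \<phi>"
  using assms(3-6)
proof (induction \<phi> arbitrary: e)
  case (Eq s t)
  then show ?case
    using tm_val_lhom[OF h M Eq.prems(3), of s] tm_val_lhom[OF h M Eq.prems(3), of t]
    by (simp add: comp_def)
next
  case (Rel R ts)
  have "set (map (tm_val M e) ts) \<subseteq> univ M" using Rel.prems tm_val_closed[OF M] by auto
  then have "rint N R (map h (map (tm_val M e) ts))"
    using Rel.prems h by (simp add: lhom_def del: map_map set_map)
  also have "map h (map (tm_val M e) ts) = map (tm_val N (h \<circ> e)) ts"
    using Rel tm_val_lhom[OF h M] by simp
  finally show ?case by (simp add: comp_def)
next
  case (Ex n \<phi>)
  then obtain a where a: "a \<in> univ M" "sat M (e(n := a)) \<phi>" by auto
  then have "sat N (h \<circ> e(n := a)) \<phi>"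
    using Ex.IH[OF _ _ range_fun_upd[OF Ex.prems(3) a(1)] a(2)] Ex.prems by (simp add: comp_def)
  moreover have "h a \<in> univ N" using h a by (simp add: lhom_def)
  ultimately show ?case unfolding sat.simps fun_upd_comp by blast
qed auto

lemma sat_foldr_AllI:
  assumes "\<And>e. range e \<subseteq> univ M \<Longrightarrow> sat M e \<chi>" "range e \<subseteq> univ M"
  shows "sat M e (foldr All xs \<chi>)"
  using assms(2)
proof (induction xs arbitrary: e)
  case (Cons x xs)
  then have "sat M (e(x := a)) (foldr All xs \<chi>)" if "a \<in> univ M" for a
    using that range_fun_upd by (intro Cons.IH)
  then show ?case by simp
qed (simp add: assms(1))

lemma sat_foldr_AllD:
  assumes "range e \<subseteq> univ M" "sat M e (foldr All xs \<chi>)"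
  shows "sat M e \<chi>"
  using assms(2)
proof (induction xs)
  case (Cons x xs)
  \<comment> \<open>Each quantifier is instantiated with the value that \<open>e\<close> already
    has, so the assignment does not change.\<close>
  then have "sat M (e(x := e x)) (foldr All xs \<chi>)" using assms(1) by (auto simp del: fun_upd_triv)
  then show ?case using Cons.IH by simp
qed simp

text \<open>A term without variables contains a constant, whose value would lie in the empty
  universe.\<close>

lemma tm_fv_nonempty:
  assumes "lstructure L M" "univ M = {}" "lterm L t"
  shows "tm_fv t \<noteq> {}"
  using assms(3)
proof (induction t)
  case (Fun f ts)
  show ?case
  proof (cases ts)
    case Nil
    then have "fint M f [] \<in> univ M" using Fun.prems assms(1) by (simp add: lstructure_def)
    then show ?thesis using assms(2) by simp
  qed (use Fun in auto)
qed simp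

section \<open>Coordinates, relations and points of a directed limit\<close>

locale directed_limit =
  fixes L :: "('f, 'r) language"
    and I :: "'i set" and r :: "'i rel"
    and D :: "'i \<Rightarrow> ('f, 'r, 'a) lstruct"
    and d :: "'i \<Rightarrow> 'i \<Rightarrow> 'a \<Rightarrow> 'a"
    and P :: "('f, 'r, 'p) lstruct"
    and \<pi> :: "'i \<Rightarrow> 'p \<Rightarrow> 'a"
  assumes directed: "downward_directed I r"
    and diagram: "diagram L I r D d"
    and limit: "limit_cone L I r D d P \<pi>"
begin

lemma order_subset: "r \<subseteq> I \<times> I"
  using directed by (auto simp: downward_directed_def partial_order_on_def preorder_on_def)

lemma order_refl: "i \<in> I \<Longrightarrow> (i, i) \<in> r"
  using directed by (auto simp: downward_directed_def partial_order_on_def preorder_on_def refl_on_def)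

lemma order_trans: "(i, j) \<in> r \<Longrightarrow> (j, k) \<in> r \<Longrightarrow> (i, k) \<in> r"
  using directed by (auto simp: downward_directed_def partial_order_on_def preorder_on_def dest: transD)

lemma lower_bound:
  assumes "i \<in> I" "j \<in> I"
  obtains k where "k \<in> I" "(k, i) \<in> r" "(k, j) \<in> r"
  using assms directed by (auto simp: downward_directed_def)

lemma lstructure_D: "i \<in> I \<Longrightarrow> lstructure L (D i)"
  using diagram by (simp add: diagram_def)

lemma lhom_d: "(i, j) \<in> r \<Longrightarrow> lhom L (D i) (D j) (d i j)"
  using diagram by (auto simp: diagram_def)

lemma cone_P: "cone L I r D d P \<pi>"
  using limit by (simp add: limit_cone_def)

lemma lstructure_P: "lstructure L P"
  using cone_P by (simp add: cone_def)

lemma lhom_\<pi>: "i \<in> I \<Longrightarrow> lhom L P (D i) (\<pi> i)"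
  using cone_P by (simp add: cone_def)

lemma \<pi>_closed: "i \<in> I \<Longrightarrow> x \<in> univ P \<Longrightarrow> \<pi> i x \<in> univ (D i)"
  using lhom_\<pi> by (simp add: lhom_def)

lemma d_\<pi>: "(i, j) \<in> r \<Longrightarrow> x \<in> univ P \<Longrightarrow> d i j (\<pi> i x) = \<pi> j x"
  using cone_P by (auto simp: cone_def)

lemma d_comp_\<pi>: "(i, j) \<in> r \<Longrightarrow> range e \<subseteq> univ P \<Longrightarrow> d i j \<circ> (\<pi> i \<circ> e) = \<pi> j \<circ> e"
  using d_\<pi> by (auto simp: fun_eq_iff)

lemma \<pi>_range: "i \<in> I \<Longrightarrow> range e \<subseteq> univ P \<Longrightarrow> range (\<pi> i \<circ> e) \<subseteq> univ (D i)"
  using \<pi>_closed by auto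

text \<open>The apex is known only by its universal property; through the isomorphism with
  \<open>families\<close> its elements become families of coordinates.\<close>

lemma \<pi>_jointly_inj:
  assumes "x \<in> univ P" "y \<in> univ P" "\<And>i. i \<in> I \<Longrightarrow> \<pi> i x = \<pi> i y"
  shows "x = y"
proof -
  obtain u where "\<And>x. x \<in> univ P \<Longrightarrow> u (\<lambda>i\<in>I. \<pi> i x) = x"
    using limit_cone_iso_families[OF limit diagram order_subset] by blast
  moreover have "(\<lambda>i\<in>I. \<pi> i x) = (\<lambda>i\<in>I. \<pi> i y)" using assms by auto
  ultimately show ?thesis using assms by metis
qed

text \<open>Homomorphisms need not reflect relations, but those of \<open>families\<close> are
  defined coordinatewise, and the isomorphism \<open>u\<close> carries them to
  \<open>P\<close>.\<close>

lemma rint_P: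
  assumes "R \<in> rsyms L" "length xs = rarity L R" "set xs \<subseteq> univ P"
    and "\<And>i. i \<in> I \<Longrightarrow> rint (D i) R (map (\<pi> i) xs)"
  shows "rint P R xs"
proof -
  let ?C = "families I r D d" and ?v = "\<lambda>x. \<lambda>i\<in>I. \<pi> i x"
  obtain u where u: "lhom L ?C P u" "lhom L P ?C ?v"
    and uv: "\<And>x. x \<in> univ P \<Longrightarrow> u (?v x) = x"
    using limit_cone_iso_families[OF limit diagram order_subset] by blast
  have "rint (D i) R (map (\<lambda>x. x i) (map ?v xs))" if "i \<in> I" for i
  proof -
    have "map (\<lambda>x. x i) (map ?v xs) = map (\<pi> i) xs" using that by simp
    then show ?thesis using assms(4)[OF that] by (simp only:)
  qed
  then have "rint ?C R (map ?v xs)" by (simp add: families_def del: map_map)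
  moreover have "set (map ?v xs) \<subseteq> univ ?C" using u(2) assms(3) by (auto simp: lhom_def)
  ultimately have "rint P R (map u (map ?v xs))"
    using u(1) assms by (simp add: lhom_def del: map_map)
  also have "map u (map ?v xs) = xs" using assms(3) uv by (auto intro!: map_idI)
  finally show ?thesis .
qed

text \<open>The compactness principle: with \<open>A i = univ (D i)\<close> it shows that the limit of nonempty finite
  structures is nonempty, with sets of witnesses it handles the existential quantifier.\<close>

lemma limit_point:
  assumes fin: "\<And>i. i \<in> I \<Longrightarrow> finite (univ (D i))"
    and A: "\<And>i. i \<in> I \<Longrightarrow> A i \<subseteq> univ (D i)" "\<And>i. i \<in> I \<Longrightarrow> A i \<noteq> {}"
    and maps: "\<And>i j a. (i, j) \<in> r \<Longrightarrow> a \<in> A i \<Longrightarrow> d i j a \<in> A j"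
  shows "\<exists>x\<in>univ P. \<forall>i\<in>I. \<pi> i x \<in> A i"
proof -
  let ?C = "families I r D d" and ?v = "\<lambda>x. \<lambda>i\<in>I. \<pi> i x"
  have "\<exists>y\<in>Pi\<^sub>E I A. \<forall>(i, j)\<in>r. d i j (y i) = y j"
  proof (rule inverse_limit_nonempty[OF directed])
    show "finite (A i)" if "i \<in> I" for i using fin A that finite_subset by metis
    show "d j k (d i j a) = d i k a" if "(i, j) \<in> r" "(j, k) \<in> r" "a \<in> A i" for i j k a
    proof -
      have "i \<in> I" using that order_subset by auto
      then show ?thesis using diagram A(1) that unfolding diagram_def by blast
    qed
  qed (use A maps in auto)
  then obtain y where y: "y \<in> Pi\<^sub>E I A" "\<forall>(i, j)\<in>r. d i j (y i) = y j" by blast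
  then have yC: "y \<in> univ ?C" using A(1) by (auto simp: families_def PiE_iff)
  obtain u where u: "lhom L ?C P u" and vu: "\<And>y. y \<in> univ ?C \<Longrightarrow> ?v (u y) = y"
    using limit_cone_iso_families[OF limit diagram order_subset] by blast
  have "u y \<in> univ P" using u yC by (simp add: lhom_def)
  moreover have "\<pi> i (u y) \<in> A i" if "i \<in> I" for i
    using fun_cong[OF vu[OF yC], of i] y(1) that by (auto simp: PiE_iff)
  ultimately show ?thesis by blast
qed

section \<open>Existential positive formulas in the limit\<close>

lemma ex_pos_limit:
  assumes fin: "\<And>i. i \<in> I \<Longrightarrow> finite (univ (D i))"
    and "ex_pos \<phi>" "lformula L \<phi>" "range e \<subseteq> univ P"
    and "\<And>i. i \<in> I \<Longrightarrow> sat (D i) (\<pi> i \<circ> e) \<phi>"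
  shows "sat P e \<phi>"
  using assms(2-5)
proof (induction \<phi> arbitrary: e)
  case Falsum
  then show ?case using directed by (auto simp: downward_directed_def)
next
  case (Eq s t)
  have "tm_val P e s = tm_val P e t"
  proof (rule \<pi>_jointly_inj)
    show "\<pi> i (tm_val P e s) = \<pi> i (tm_val P e t)" if "i \<in> I" for i
      using Eq.prems(2) Eq.prems(4)[OF that] tm_val_lhom[OF lhom_\<pi>[OF that] lstructure_P Eq.prems(3), of s]
        tm_val_lhom[OF lhom_\<pi>[OF that] lstructure_P Eq.prems(3), of t] by (simp add: comp_def)
  qed (use Eq tm_val_closed[OF lstructure_P] in auto)
  then show ?case by simp
next
  case (Rel R ts)
  have "rint P R (map (tm_val P e) ts)"
  proof (rule rint_P)
    fix i assume i: "i \<in> I"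
    have eq: "map (\<pi> i) (map (tm_val P e) ts) = map (tm_val (D i) (\<pi> i \<circ> e)) ts"
      using Rel tm_val_lhom[OF lhom_\<pi>[OF i] lstructure_P] by simp
    show "rint (D i) R (map (\<pi> i) (map (tm_val P e) ts))"
      unfolding eq using Rel.prems(4)[OF i] by (simp add: comp_def)
  qed (use Rel tm_val_closed[OF lstructure_P] in auto)
  then show ?case by simp
next
  case (Or \<phi> \<psi>)
  have down: "sat (D j) (\<pi> j \<circ> e) \<chi>"
    if "(i, j) \<in> r" "ex_pos \<chi>" "lformula L \<chi>" "sat (D i) (\<pi> i \<circ> e) \<chi>" for i j \<chi>
  proof -
    have "i \<in> I" using that order_subset by auto
    then show ?thesis
      using ex_pos_lhom[OF lhom_d[OF that(1)] lstructure_D that(2,3) \<pi>_range that(4)] Or.prems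
      unfolding d_comp_\<pi>[OF that(1) Or.prems(3)] by blast
  qed
  \<comment> \<open>If one disjunct failed at \<open>i\<close> and the other at \<open>j\<close>,
    both would fail at a common lower bound \<open>k\<close>, because truth at \<open>k\<close>
    passes along the transition maps to \<open>i\<close> and \<open>j\<close>.\<close>
  have "(\<forall>i\<in>I. sat (D i) (\<pi> i \<circ> e) \<phi>) \<or> (\<forall>i\<in>I. sat (D i) (\<pi> i \<circ> e) \<psi>)"
  proof (rule ccontr)
    assume "\<not> ?thesis"
    then obtain i j where ij: "i \<in> I" "j \<in> I"
      "\<not> sat (D i) (\<pi> i \<circ> e) \<phi>" "\<not> sat (D j) (\<pi> j \<circ> e) \<psi>" by blast
    obtain k where "k \<in> I" "(k, i) \<in> r" "(k, j) \<in> r" using lower_bound[OF ij(1,2)] .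
    then show False
      using Or.prems(1,2) Or.prems(4)[of k] ij(3,4) down
      unfolding sat.simps ex_pos.simps lformula.simps by blast
  qed
  then show ?case using Or by (auto simp: comp_def)
next
  case (Ex n \<phi>)
  \<comment> \<open>The witnesses at each index form an inverse system, as transition maps preserve
    \<open>\<phi>\<close>. A point of \<open>P\<close> projecting to witnesses everywhere is itself
    a witness by the induction hypothesis.\<close>
  define A where "A i = {a \<in> univ (D i). sat (D i) ((\<pi> i \<circ> e)(n := a)) \<phi>}" for i
  have "\<exists>x\<in>univ P. \<forall>i\<in>I. \<pi> i x \<in> A i"
  proof (rule limit_point[OF fin])
    fix i j a assume ij: "(i, j) \<in> r" and "a \<in> A i"
    then have a: "a \<in> univ (D i)" "sat (D i) ((\<pi> i \<circ> e)(n := a)) \<phi>" by (auto simp: A_def)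
    have i: "i \<in> I" using ij order_subset by auto
    have "sat (D j) (d i j \<circ> (\<pi> i \<circ> e)(n := a)) \<phi>"
      using ex_pos_lhom[OF lhom_d[OF ij] lstructure_D[OF i] _ _
        range_fun_upd[OF \<pi>_range[OF i Ex.prems(3)] a(1)] a(2)] Ex.prems(1,2) by simp
    moreover have "d i j a \<in> univ (D j)" using lhom_d[OF ij] a(1) by (simp add: lhom_def)
    ultimately show "d i j a \<in> A j"
      using d_comp_\<pi>[OF ij, of e] Ex.prems by (simp add: A_def fun_upd_comp)
  qed (use Ex.prems(4) in \<open>auto simp: A_def comp_def\<close>)
  then obtain x where x: "x \<in> univ P" "\<And>i. i \<in> I \<Longrightarrow> \<pi> i x \<in> A i" by blast
  have "sat P (e(n := x)) \<phi>"
  proof (rule Ex.IH)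
    show "sat (D i) (\<pi> i \<circ> e(n := x)) \<phi>" if "i \<in> I" for i
      using x(2)[OF that] unfolding fun_upd_comp A_def by blast
  qed (use Ex.prems(1,2) range_fun_upd[OF Ex.prems(3) x(1)] in simp_all)
  then show ?case using x(1) by auto
qed auto

section \<open>Sentences over the empty universe\<close>

text \<open>Induction over all formulas, positive or not: below \<open>i0\<close> and in
  \<open>P\<close> every universe is empty, so quantified formulas have a fixed truth value, and
  closed atomic formulas are \<open>Falsum\<close> or relations of arity 0. Agreement is claimed
  only below some index, which directedness makes stable under connectives.\<close>

lemma sat_sentence_empty_limit:
  assumes "i0 \<in> I" "univ (D i0) = {}" "lformula L \<phi>" "fv \<phi> = {}"
  shows "\<exists>i\<in>I. \<forall>j. (j, i) \<in> r \<longrightarrow> sat (D j) e \<phi> = sat P e' \<phi>"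
proof -
  have empty: "univ (D j) = {}" if "(j, i0) \<in> r" for j
    using lhom_d[OF that] assms(2) by (auto simp: lhom_def)
  have emptyP: "univ P = {}" using \<pi>_closed[OF assms(1)] assms(2) by auto
  have merge: "\<exists>k\<in>I. \<forall>j. (j, k) \<in> r \<longrightarrow> X j \<and> Y j"
    if XY: "\<exists>i\<in>I. \<forall>j. (j, i) \<in> r \<longrightarrow> X j" "\<exists>i\<in>I. \<forall>j. (j, i) \<in> r \<longrightarrow> Y j" for X Y
  proof -
    obtain i j where ij: "i \<in> I" "j \<in> I" "\<And>l. (l, i) \<in> r \<Longrightarrow> X l" "\<And>l. (l, j) \<in> r \<Longrightarrow> Y l"
      using XY by blast
    obtain k where "k \<in> I" "(k, i) \<in> r" "(k, j) \<in> r" using lower_bound[OF ij(1,2)] .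
    then show ?thesis using ij order_trans by blast
  qed
  show ?thesis
    using assms(3,4)
  proof (induction \<phi>)
    case Falsum
    then show ?case using assms(1) by auto
  next
    case (Eq s t)
    then show ?case using tm_fv_nonempty[OF lstructure_P emptyP, of s] by simp
  next
    case (Rel R ts)
    have ts: "ts = []"
      using Rel tm_fv_nonempty[OF lstructure_P emptyP] by (cases ts) auto
    show ?case
    \<comment> \<open>Truth in \<open>P\<close> descends along the projections. Falsity in
      \<open>P\<close> means falsity at some \<open>i\<close>, hence at all lower indices, since
      transition maps preserve \<open>R\<close>.\<close>
    proof (cases "rint P R []")
      case True
      have "rint (D j) R []" if "(j, i0) \<in> r" for j
      proof -
        have "j \<in> I" using that order_subset by auto
        from lhom_\<pi>[OF this] show ?thesis using True Rel ts by (fastforce simp: lhom_def)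
      qed
      then show ?thesis using True ts assms(1) by auto
    next
      case False
      then obtain i where i: "i \<in> I" "\<not> rint (D i) R []"
        using rint_P[of R "[]"] Rel ts by auto
      have "\<not> rint (D j) R []" if "(j, i) \<in> r" for j
        using lhom_d[OF that] i Rel ts by (fastforce simp: lhom_def)
      then show ?thesis using False ts i by auto
    qed
  next
    case (And \<phi> \<psi>)
    have "\<exists>k\<in>I. \<forall>j. (j, k) \<in> r \<longrightarrow> sat (D j) e \<phi> = sat P e' \<phi> \<and> sat (D j) e \<psi> = sat P e' \<psi>"
      using And by (intro merge) auto
    then show ?case by auto
  next
    case (Or \<phi> \<psi>)
    have "\<exists>k\<in>I. \<forall>j. (j, k) \<in> r \<longrightarrow> sat (D j) e \<phi> = sat P e' \<phi> \<and> sat (D j) e \<psi> = sat P e' \<psi>"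
      using Or by (intro merge) auto
    then show ?case by auto
  next
    case (Imp \<phi> \<psi>)
    have "\<exists>k\<in>I. \<forall>j. (j, k) \<in> r \<longrightarrow> sat (D j) e \<phi> = sat P e' \<phi> \<and> sat (D j) e \<psi> = sat P e' \<psi>"
      using Imp by (intro merge) auto
    then show ?case by auto
  next
    case (Ex n \<phi>)
    show ?case using emptyP empty by (intro bexI[OF _ assms(1)]) auto
  next
    case (All n \<phi>)
    show ?case using emptyP empty by (intro bexI[OF _ assms(1)]) auto
  qed auto
qed

section \<open>Transfer of the axioms to the limit\<close>

text \<open>The premise goes down to each \<open>D i\<close> along the projection, the implication
  is applied there, and the conclusion is lifted to \<open>P\<close>. The assignment
  \<open>e\<close> makes all universes involved nonempty, so both formulas may be replaced by
  existential positive equivalents.\<close>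

lemma ex_pos_class_implication_limit:
  assumes fin: "\<And>i. i \<in> I \<Longrightarrow> finite (univ (D i))"
    and \<psi>: "\<psi>0 \<in> ex_pos_class L" "\<psi>1 \<in> ex_pos_class L"
    and imp: "\<And>i e. i \<in> I \<Longrightarrow> range e \<subseteq> univ (D i) \<Longrightarrow> sat (D i) e (Imp \<psi>0 \<psi>1)"
    and e: "range e \<subseteq> univ P"
  shows "sat P e (Imp \<psi>0 \<psi>1)"
proof -
  obtain \<phi>0 \<phi>1 where
    0: "lformula L \<psi>0" "lformula L \<phi>0" "ex_pos \<phi>0" "logically_equivalent L \<psi>0 \<phi>0" and
    1: "lformula L \<psi>1" "lformula L \<phi>1" "ex_pos \<phi>1" "logically_equivalent L \<psi>1 \<phi>1"
    using \<psi> by (auto simp: ex_pos_class_def)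
  have "sat P e \<phi>1" if "sat P e \<phi>0"
  proof (rule ex_pos_limit[OF fin 1(3,2) e])
    fix i assume i: "i \<in> I"
    note re = \<pi>_range[OF i e]
    have "sat (D i) (\<pi> i \<circ> e) \<phi>0"
      using ex_pos_lhom[OF lhom_\<pi>[OF i] lstructure_P 0(3,2) e that] .
    then show "sat (D i) (\<pi> i \<circ> e) \<phi>1"
      using imp[OF i re] logically_equivalentD[OF 0(4,1,2) lstructure_D[OF i] re]
        logically_equivalentD[OF 1(4,1,2) lstructure_D[OF i] re] by simp
  qed
  then show ?thesis
    using logically_equivalentD[OF 0(4,1,2) lstructure_P e]
      logically_equivalentD[OF 1(4,1,2) lstructure_P e] by simp
qed

end

theorem corollary22:
  fixes L :: "('f, 'r) language"
    and T :: "('f, 'r) fm set"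
    and I :: "'i set" and r :: "'i rel"
    and D :: "'i \<Rightarrow> ('f, 'r, 'a) lstruct"
    and d :: "'i \<Rightarrow> 'i \<Rightarrow> 'a \<Rightarrow> 'a"
    and P :: "('f, 'r, 'p) lstruct"
    and \<pi> :: "'i \<Rightarrow> 'p \<Rightarrow> 'a"
  assumes axioms: "\<And>\<sigma>. \<sigma> \<in> T \<Longrightarrow> lsentence L \<sigma> \<and>
      (\<exists>xs \<psi>0 \<psi>1. \<psi>0 \<in> ex_pos_class L \<and> \<psi>1 \<in> ex_pos_class L \<and> \<sigma> = foldr All xs (Imp \<psi>0 \<psi>1))"
    and poset: "downward_directed I r"
    and diagram: "diagram L I r D d"
    and finite: "\<And>i. i \<in> I \<Longrightarrow> finite (univ (D i))"
    and models: "\<And>i. i \<in> I \<Longrightarrow> is_model L T (D i)"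
    and limit: "limit_cone L I r D d P \<pi>"
  shows "is_model L T P"
proof -
  interpret directed_limit L I r D d P \<pi>
    by standard (fact poset diagram limit)+
  have "sat P e \<sigma>" if \<sigma>: "\<sigma> \<in> T" for \<sigma> e
  proof -
    have sentence: "lformula L \<sigma>" "fv \<sigma> = {}" using axioms[OF \<sigma>] by (auto simp: lsentence_def)
    have D: "sat (D i) e1 \<sigma>" if "i \<in> I" for i e1
      using models[OF that] \<sigma> by (simp add: is_model_def)
    show ?thesis
    proof (cases "univ P = {}")
      case True
      \<comment> \<open>Were all \<open>D i\<close> nonempty, compactness applied to the full
        universes would give a point of \<open>P\<close>.\<close>
      have "\<exists>i0\<in>I. univ (D i0) = {}"
      proof (rule ccontr)
        assume "\<not> ?thesis"
        then have "\<exists>x\<in>univ P. \<forall>i\<in>I. \<pi> i x \<in> univ (D i)"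
          using lhom_d by (intro limit_point finite) (auto simp: lhom_def)
        then show False using True by simp
      qed
      then obtain i where "i \<in> I" "\<forall>j. (j, i) \<in> r \<longrightarrow> sat (D j) undefined \<sigma> = sat P e \<sigma>"
        using sat_sentence_empty_limit[OF _ _ sentence] by blast
      \<comment> \<open>The agreement is used at \<open>i\<close> itself, where
        \<open>\<sigma>\<close> holds under every assignment, in particular
        \<open>undefined\<close>.\<close>
      then show ?thesis using D order_refl by blast
    next
      case False
      then obtain a where a: "a \<in> univ P" by blast
      obtain xs \<psi>0 \<psi>1 where \<psi>: "\<psi>0 \<in> ex_pos_class L" "\<psi>1 \<in> ex_pos_class L"
        and eq: "\<sigma> = foldr All xs (Imp \<psi>0 \<psi>1)" using axioms[OF \<sigma>] by blast
      have "sat P e1 (Imp \<psi>0 \<psi>1)" if "range e1 \<subseteq> univ P" for e1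
      proof (rule ex_pos_class_implication_limit[OF finite \<psi> _ that])
        show "sat (D i) e2 (Imp \<psi>0 \<psi>1)" if "i \<in> I" "range e2 \<subseteq> univ (D i)" for i e2
          using sat_foldr_AllD[OF that(2)] D[OF that(1)] unfolding eq by blast
      qed
      \<comment> \<open>The given \<open>e\<close> may leave the universe; a constant assignment
        inside it suffices because \<open>\<sigma>\<close> is closed.\<close>
      then have "sat P (\<lambda>_. a) \<sigma>" unfolding eq using a by (intro sat_foldr_AllI) auto
      then show ?thesis using sat_cong[of \<sigma> "\<lambda>_. a" e P] sentence by simp
    qed
  qed
  then show ?thesis using lstructure_P by (simp add: is_model_def)
qed

end
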